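(* For all integers $t$ and $r$ with $t \geq r \geq 3$, we have $\mathrm{cov}(r, r+t) = t+1$. That is: (i) for every complete $r$-partite $r$-uniform hypergraph $H$ and every spanning $(r+t)$-coloring of the edges of $H$, the vertex set $V(H)$ can be covered by the vertex sets of at most $t+1$ monochromatic components; and (ii) there exist a complete $r$-partite $r$-uniform hypergraph $H$ and a spanning $(r+t)$-coloring of its edges for which $V(H)$ cannot be covered by the vertex sets of $t$ or fewer monochromatic components.
   Context: A complete $r$-partite $r$-uniform hypergraph $H$ has vertex set partitioned into nonempty parts $V_1,\dots,V_r$ and edge set $\{\{v_1,\dots,v_r\} : v_i \in V_i \text{ for all } i \in [r]\}$. A $k$-coloring of the edges is an assignment of one of $k$ colors to each edge; it is spanning if every vertex is contained in edges of every one of the $k$ colors. A (connected) component of a hypergraph is a maximal subhypergraph in which any two vertices are joined by a sequence of edges of the subhypergraph, the first containing one vertex, the last containing the other, and consecutive edges intersecting (the sequence may be empty, so an isolated vertex forms a component). A monochromatic component of color $c$ is a component of the subhypergraph consisting of all edges of color $c$ (on the full vertex set). A set of monochromatic components covers $V(H)$ if every vertex lies in one of them. The covering number $\mathrm{cov}(r,k)$ is the minimum integer $\ell$ such that for every spanning $k$-coloring of the edges of every complete $r$-partite $r$-uniform hypergraph $H$, $V(H)$ can be covered by at most $\ell$ monochromatic components. *)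

theory Defs
  imports Main "HOL-Library.Disjoint_Sets" "HOL-Library.Infinite_Typeclass"
begin

datatype 'v hypergraph = Hypergraph (verts: "'v set") (edges: "'v set set")

definition complete_partite :: "nat \<Rightarrow> 'v hypergraph \<Rightarrow> bool" where
  "complete_partite r H \<longleftrightarrow>
     (\<exists>V :: nat \<Rightarrow> 'v set.
        (\<forall>i\<in>{1..r}. V i \<noteq> {}) \<and>
        disjoint_family_on V {1..r} \<and>
        verts H = (\<Union>i\<in>{1..r}. V i) \<and>
        edges H = {v ` {1..r} | v. \<forall>i\<in>{1..r}. v i \<in> V i})"

definition spanning_coloring :: "'v hypergraph \<Rightarrow> nat \<Rightarrow> ('v set \<Rightarrow> nat) \<Rightarrow> bool" where
  "spanning_coloring H k f \<longleftrightarrow>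
     (\<forall>e\<in>edges H. f e \<in> {1..k}) \<and>
     (\<forall>x\<in>verts H. \<forall>c\<in>{1..k}. \<exists>e\<in>edges H. x \<in> e \<and> f e = c)"

definition subhypergraph :: "'v hypergraph \<Rightarrow> 'v hypergraph \<Rightarrow> bool" where
  "subhypergraph C H \<longleftrightarrow>
     verts C \<subseteq> verts H \<and> edges C \<subseteq> edges H \<and> (\<forall>e\<in>edges C. e \<subseteq> verts C)"

text \<open>The disjunct \<open>x = y\<close> accounts for the empty sequence of edges.\<close>

definition joined :: "'v hypergraph \<Rightarrow> 'v \<Rightarrow> 'v \<Rightarrow> bool" where
  "joined H x y \<longleftrightarrow> x = y \<or>
     (\<exists>es. es \<noteq> [] \<and> set es \<subseteq> edges H \<and> x \<in> hd es \<and> y \<in> last es \<and>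
           successively (\<lambda>e e'. e \<inter> e' \<noteq> {}) es)"

definition connected_hypergraph :: "'v hypergraph \<Rightarrow> bool" where
  "connected_hypergraph H \<longleftrightarrow> (\<forall>x\<in>verts H. \<forall>y\<in>verts H. joined H x y)"

definition component :: "'v hypergraph \<Rightarrow> 'v hypergraph \<Rightarrow> bool" where
  "component H C \<longleftrightarrow>
     subhypergraph C H \<and> connected_hypergraph C \<and>
     (\<forall>D. subhypergraph D H \<and> connected_hypergraph D \<and> subhypergraph C D \<longrightarrow> D = C)"

definition color_class :: "'v hypergraph \<Rightarrow> ('v set \<Rightarrow> nat) \<Rightarrow> nat \<Rightarrow> 'v hypergraph" where
  "color_class H f c = Hypergraph (verts H) {e \<in> edges H. f e = c}"

definition mono_component ::
  "'v hypergraph \<Rightarrow> nat \<Rightarrow> ('v set \<Rightarrow> nat) \<Rightarrow> 'v hypergraph \<Rightarrow> bool" where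
  "mono_component H k f C \<longleftrightarrow> (\<exists>c\<in>{1..k}. component (color_class H f c) C)"

definition coverable :: "'v hypergraph \<Rightarrow> nat \<Rightarrow> ('v set \<Rightarrow> nat) \<Rightarrow> nat \<Rightarrow> bool" where
  "coverable H k f l \<longleftrightarrow>
     (\<exists>S. finite S \<and> card S \<le> l \<and> (\<forall>C\<in>S. mono_component H k f C) \<and>
          verts H \<subseteq> (\<Union>C\<in>S. verts C))"

text \<open>
  HOL cannot quantify over the type of vertices inside a definition, so the covering number
  takes it as a parameter. The sort \<open>infinite\<close> ensures that every finite hypergraph
  occurs, up to isomorphism, with vertices in \<open>'v\<close>.
\<close>

definition cov :: "'v::infinite itself \<Rightarrow> nat \<Rightarrow> nat \<Rightarrow> nat" where
  "cov _ r k =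
     (LEAST l. \<forall>(H :: 'v hypergraph) f.
        complete_partite r H \<and> spanning_coloring H k f \<longrightarrow> coverable H k f l)"

end

theory Submission
  imports Defs
begin

text \<open>
  Identify a vertex with the vector of its \<open>k = r + t\<close> monochromatic components. Any \<open>r\<close> vertices
  from different parts agree in some coordinate, and every component meets every part. Suppose
  that no \<open>t + 1\<close> components cover. Then every colour has at least \<open>t + 2\<close> components. If all
  vertices of a transversal but the one in part \<open>i\<close> agree exactly in the colours of \<open>A\<close>, their
  components in these colours cover part \<open>i\<close>. Hence the components shared by at least \<open>r - 1\<close>
  vertices of a transversal cover everything, so every transversal has at most \<open>r - 2\<close> bad
  colours, in which no \<open>r - 1\<close> of its vertices agree. On the other hand, there are two vertices
  of different parts that differ in \<open>r\<close> colours, and each further vertex can be chosen to take a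
  third value in one of these. This makes \<open>r - 2\<close> colours bad; a short analysis of three (for
  \<open>r = 3\<close>) or four parts (for \<open>r \<ge> 4\<close>) gains the missing one.

  For the lower bound, take vectors over \<open>{0..t}\<close> with at most \<open>t\<close> nonzero entries in one part and
  at most one nonzero entry in each of the others. Any \<open>t\<close> components miss some vertex of the
  first part.
\<close>

section \<open>Transversals and their bad colours\<close>

lemma card_filter_complement:
  "card {c\<in>{1..n}. P c} + card {c\<in>{1..n}. \<not> P c} = n" for n :: nat
proof -
  have "card {c\<in>{1..n}. P c} + card {c\<in>{1..n}. \<not> P c} =
      card ({c\<in>{1..n}. P c} \<union> {c\<in>{1..n}. \<not> P c})"
    by (rule card_Un_disjoint[symmetric]) auto
  also have "{c\<in>{1..n}. P c} \<union> {c\<in>{1..n}. \<not> P c} = {1..n}"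
    by blast
  finally show ?thesis
    by simp
qed

text \<open>Here \<open>g c x\<close> stands for the component of colour \<open>c\<close> that contains \<open>x\<close>. The assumptions
  turn out to be contradictory.\<close>

locale uncoverable_parts =
  fixes r t :: nat and F :: "nat \<Rightarrow> 'v set" and g :: "nat \<Rightarrow> 'v \<Rightarrow> 'b"
  assumes r_ge_3: "3 \<le> r" and r_le_t: "r \<le> t"
    and agreement: "\<And>v. (\<And>i. i \<in> {1..r} \<Longrightarrow> v i \<in> F i) \<Longrightarrow>
      \<exists>c\<in>{1..r+t}. \<forall>i\<in>{1..r}. \<forall>j\<in>{1..r}. g c (v i) = g c (v j)"
    and transfer: "\<And>i j c x. i \<in> {1..r} \<Longrightarrow> j \<in> {1..r} \<Longrightarrow> c \<in> {1..r+t} \<Longrightarrow> x \<in> F i \<Longrightarrow>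
      \<exists>y\<in>F j. g c y = g c x"
    and uncovered: "\<And>S. finite S \<Longrightarrow> card S \<le> t + 1 \<Longrightarrow>
      \<exists>i\<in>{1..r}. \<exists>x\<in>F i. \<forall>c\<in>{1..r+t}. (c, g c x) \<notin> S"
begin

text \<open>The pairs of \<open>c\<close> with values in \<open>X\<close> miss some vertex, and
  \<open>transfer\<close> moves its value into part \<open>i\<close>.\<close>

lemma new_value:
  assumes "finite X" "card X \<le> t + 1" "i \<in> {1..r}" "c \<in> {1..r+t}"
  obtains y where "y \<in> F i" "g c y \<notin> X"
proof -
  have "card ({c} \<times> X) \<le> t + 1"
    using assms by (simp add: card_cartesian_product)
  then obtain j x where "j \<in> {1..r}" "x \<in> F j" "\<forall>d\<in>{1..r+t}. (d, g d x) \<notin> {c} \<times> X"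
    using uncovered[of "{c} \<times> X"] assms by blast
  then show thesis
    using transfer[of j i c x] assms that by fastforce
qed

lemma new_value_2:
  assumes "i \<in> {1..r}" "c \<in> {1..r+t}"
  obtains y where "y \<in> F i" "g c y \<noteq> a" "g c y \<noteq> b"
proof -
  have "card {a, b} \<le> t + 1"
    using r_ge_3 r_le_t by (simp add: card_insert_if)
  then show thesis
    using new_value[of "{a, b}" i c] assms that by auto
qed

lemma new_value_4:
  assumes "i \<in> {1..r}" "c \<in> {1..r+t}"
  obtains y where "y \<in> F i" "g c y \<noteq> a" "g c y \<noteq> b" "g c y \<noteq> d" "g c y \<noteq> e"
proof -
  have "card {a, b, d, e} \<le> t + 1"
    using r_ge_3 r_le_t by (simp add: card_insert_if)
  then show thesis
    using new_value[of "{a, b, d, e}" i c] assms that by auto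
qed

text \<open>The removed index \<open>i\<close> may lie outside \<open>I\<close>, so a bad colour is
  in particular nonconstant on \<open>I\<close>.\<close>

definition bad :: "nat set \<Rightarrow> (nat \<Rightarrow> 'v) \<Rightarrow> nat \<Rightarrow> bool" where
  "bad I v c \<longleftrightarrow> (\<forall>i. \<exists>j\<in>I - {i}. \<exists>l\<in>I - {i}. g c (v j) \<noteq> g c (v l))"

text \<open>With \<open>r - 1\<close> bad colours at most \<open>t + 1\<close> others remain, and
  the components shared there by all vertices but at most one miss some \<open>x\<close>. Exchanging
  \<open>x\<close> into the transversal gives, by \<open>agreement\<close>, a colour of
  \<open>N\<close> in which \<open>x\<close> has the shared value.\<close>

lemma card_bad_le:
  assumes v: "\<And>i. i \<in> {1..r} \<Longrightarrow> v i \<in> F i"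
  shows "card {c\<in>{1..r+t}. bad {1..r} v c} \<le> r - 2"
proof (rule ccontr)
  assume many: "\<not> ?thesis"
  define N where "N = {c\<in>{1..r+t}. \<not> bad {1..r} v c}"
  have "card {c\<in>{1..r+t}. bad {1..r} v c} + card N = r + t"
    unfolding N_def by (rule card_filter_complement)
  with many have card_N: "card N \<le> t + 1"
    by simp
  have "\<exists>i a. \<forall>j\<in>{1..r} - {i}. g c (v j) = a" if "c \<in> N" for c
    using that unfolding N_def bad_def by blast
  then obtain h a where ha: "\<And>c j. c \<in> N \<Longrightarrow> j \<in> {1..r} - {h c} \<Longrightarrow> g c (v j) = a c"
    by metis
  have "finite N"
    by (simp add: N_def)
  then have "card ((\<lambda>c. (c, a c)) ` N) \<le> t + 1"
    using card_image_le[of N "\<lambda>c. (c, a c)"] card_N by linarith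
  then obtain i x where ix: "i \<in> {1..r}" "x \<in> F i"
    and x: "\<And>c. c \<in> {1..r+t} \<Longrightarrow> (c, g c x) \<notin> (\<lambda>c. (c, a c)) ` N"
    using uncovered[of "(\<lambda>c. (c, a c)) ` N"] \<open>finite N\<close> by blast
  have "(v(i := x)) j \<in> F j" if "j \<in> {1..r}" for j
    using v[OF that] ix by simp
  then obtain c where c: "c \<in> {1..r+t}"
    "\<forall>j\<in>{1..r}. \<forall>l\<in>{1..r}. g c ((v(i := x)) j) = g c ((v(i := x)) l)"
    using agreement[of "v(i := x)"] by blast
  have eq: "g c (v j) = g c x" if "j \<in> {1..r} - {i}" for j
    using bspec[OF bspec[OF c(2) ix(1)], of j] that by simp
  have "\<not> bad {1..r} v c"
    unfolding bad_def using eq by metis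
  then have "c \<in> N"
    using c by (simp add: N_def)
  \<comment> \<open>As \<open>3 \<le> r\<close>, an index besides \<open>i\<close> and
    \<open>h c\<close> exists; it links the value of \<open>x\<close> with
    \<open>a c\<close>.\<close>
  have "\<not> {1..r} \<subseteq> {i, h c}"
    using card_mono[of "{i, h c}" "{1..r}"] r_ge_3 by (auto simp: card_insert_if split: if_splits)
  then obtain j where "j \<in> {1..r} - {i, h c}"
    by blast
  then have "g c x = a c"
    using eq ha[OF \<open>c \<in> N\<close>] by (metis Diff_iff insert_iff)
  then show False
    using x[OF c(1)] \<open>c \<in> N\<close> by blast
qed

text \<open>Each further vertex can be chosen to make one more of the nonconstant colours bad,
  by giving it a third value there.\<close>

lemma not_too_bad:
  assumes "I \<subseteq> {1..r}" "\<And>i. i \<in> I \<Longrightarrow> v i \<in> F i"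
    and "N \<subseteq> {1..r+t}" "r - 1 \<le> card N"
    and "\<And>c. c \<in> N \<Longrightarrow> \<exists>j\<in>I. \<exists>l\<in>I. g c (v j) \<noteq> g c (v l)"
    and "P \<subseteq> N" "\<And>c. c \<in> P \<Longrightarrow> bad I v c" "card I \<le> card P + 1"
  shows False
  using assms
proof (induction "r - card I" arbitrary: I v P)
  case 0
  have "card I \<le> r"
    using card_mono[OF _ 0(2)] by simp
  then have "I = {1..r}"
    using card_subset_eq[OF _ 0(2)] 0(1) by simp
  then have "P \<subseteq> {c\<in>{1..r+t}. bad {1..r} v c}"
    using 0 by blast
  \<comment> \<open>With all \<open>r\<close> parts in use, \<open>P\<close> has at least
    \<open>r - 1\<close> bad colours, one too many.\<close>
  then have "card P \<le> card {c\<in>{1..r+t}. bad {1..r} v c}"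
    by (intro card_mono) auto
  also have "\<dots> \<le> r - 2"
    using 0 \<open>I = {1..r}\<close> by (intro card_bad_le) auto
  finally show False
    using 0 \<open>I = {1..r}\<close> r_ge_3 by simp
next
  case (Suc n)
  have fin: "finite I" "finite N" "finite P"
    using Suc.prems finite_subset by (metis finite_atLeastAtMost)+
  have "\<not> {1..r} \<subseteq> I"
    using Suc.hyps(2) card_mono[OF fin(1), of "{1..r}"] by fastforce
  then obtain j where j: "j \<in> {1..r}" "j \<notin> I"
    by blast
  have card_I: "card (insert j I) = Suc (card I)"
    using fin j by simp
  have dec: "n = r - card (insert j I)"
    using Suc.hyps(2) card_I by simp
  have nonconst: "\<exists>i\<in>insert j I. \<exists>l\<in>insert j I. g c ((v(j := y)) i) \<noteq> g c ((v(j := y)) l)"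
    if c: "c \<in> N" for c y
  proof -
    obtain a b where "a \<in> I" "b \<in> I" "g c (v a) \<noteq> g c (v b)"
      using Suc.prems(5)[OF c] by blast
    then show ?thesis
      using j by (intro bexI[of _ a] bexI[of _ b]) auto
  qed
  have still_bad: "bad (insert j I) (v(j := y)) c" if c: "c \<in> P" for c y
    unfolding bad_def
  proof
    fix i
    obtain a b where "a \<in> I - {i}" "b \<in> I - {i}" "g c (v a) \<noteq> g c (v b)"
      using Suc.prems(7)[OF c] unfolding bad_def by blast
    then show "\<exists>a\<in>insert j I - {i}. \<exists>b\<in>insert j I - {i}. g c ((v(j := y)) a) \<noteq> g c ((v(j := y)) b)"
      using j by (intro bexI[of _ a] bexI[of _ b]) auto
  qed
  show False
  proof (cases "P = N")
    \<comment> \<open>All of \<open>N\<close> is bad already, so any vertex will do: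
      \<open>card I < r\<close> and \<open>r - 1 \<le> card N\<close> preserve the count.\<close>
    case True
    obtain y where "y \<in> F j"
      using new_value_2[OF j(1), of 1] r_ge_3 by fastforce
    show False
    proof (rule Suc.hyps(1)[OF dec, of "v(j := y)" P])
      show "card (insert j I) \<le> card P + 1"
        using Suc.prems(4) Suc.hyps(2) card_I unfolding True by simp
    qed (use Suc.prems j \<open>y \<in> F j\<close> nonconst still_bad in auto)
  next
    case False
    then obtain c where c: "c \<in> N" "c \<notin> P"
      using Suc.prems(6) by blast
    obtain a b where ab: "a \<in> I" "b \<in> I" "g c (v a) \<noteq> g c (v b)"
      using Suc.prems(5)[OF c(1)] by blast
    obtain y where y: "y \<in> F j" "g c y \<noteq> g c (v a)" "g c y \<noteq> g c (v b)"
      using new_value_2[OF j(1)] c(1) Suc.prems(3) by blast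
    have new_bad: "bad (insert j I) (v(j := y)) c"
      unfolding bad_def
    proof
      fix i
      \<comment> \<open>In \<open>c\<close> the vertices at \<open>a\<close>, \<open>b\<close>
        differ from each other and from \<open>y\<close>, and any removal leaves two of the
        three.\<close>
      consider "i \<noteq> a" "i \<noteq> b" | "i \<noteq> a" "i \<noteq> j" | "i \<noteq> b" "i \<noteq> j"
        using ab j by metis
      then show "\<exists>a\<in>insert j I - {i}. \<exists>b\<in>insert j I - {i}. g c ((v(j := y)) a) \<noteq> g c ((v(j := y)) b)"
      proof cases
        case 1
        then show ?thesis using ab j by (intro bexI[of _ a] bexI[of _ b]) auto
      next
        case 2
        then show ?thesis using ab j y by (intro bexI[of _ a] bexI[of _ j]) auto
      next
        case 3
        then show ?thesis using ab j y by (intro bexI[of _ b] bexI[of _ j]) auto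
      qed
    qed
    show False
    proof (rule Suc.hyps(1)[OF dec, of "v(j := y)" "insert c P"])
      show "card (insert j I) \<le> card (insert c P) + 1"
        using Suc.prems(8) card_I fin c by simp
    qed (use Suc.prems j y c nonconst still_bad new_bad in auto)
  qed
qed

section \<open>Forbidden triples and quadruples\<close>

lemma no_bad_triple:
  assumes idx: "p \<in> {1..r}" "q \<in> {1..r}" "s \<in> {1..r}" "p \<noteq> q" "p \<noteq> s" "q \<noteq> s"
    and vs: "x \<in> F p" "y \<in> F q" "z \<in> F s"
    and r: "r = 3" and c: "c \<in> {1..r+t}" "d \<in> {1..r+t}" "c \<noteq> d"
    and three: "\<And>e. e \<in> {c, d} \<Longrightarrow> g e x \<noteq> g e y \<and> g e x \<noteq> g e z \<and> g e y \<noteq> g e z"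
  shows False
proof (rule not_too_bad)
  let ?v = "\<lambda>i. if i = p then x else if i = q then y else z"
  show "\<And>i. i \<in> {p, q, s} \<Longrightarrow> ?v i \<in> F i"
    using idx vs by auto
  show "\<exists>j\<in>{p, q, s}. \<exists>l\<in>{p, q, s}. g e (?v j) \<noteq> g e (?v l)" if "e \<in> {c, d}" for e
    using three[OF that] idx by auto
  show "bad {p, q, s} ?v e" if "e \<in> {c, d}" for e
    unfolding bad_def
  proof
    fix i
    consider "i \<noteq> p" "i \<noteq> q" | "i \<noteq> p" "i \<noteq> s" | "i \<noteq> q" "i \<noteq> s"
      using idx by metis
    then show "\<exists>j\<in>{p, q, s} - {i}. \<exists>l\<in>{p, q, s} - {i}. g e (?v j) \<noteq> g e (?v l)"
    proof cases
      case 1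
      then show ?thesis using three[OF that] idx by (intro bexI[of _ p] bexI[of _ q]) auto
    next
      case 2
      then show ?thesis using three[OF that] idx by (intro bexI[of _ p] bexI[of _ s]) auto
    next
      case 3
      then show ?thesis using three[OF that] idx by (intro bexI[of _ q] bexI[of _ s]) auto
    qed
  qed
qed (use idx r c in auto)

text \<open>In \<open>c\<close>, \<open>d\<close>, \<open>b\<close> no three of the four vertices
  agree, so these colours are bad; four parts with three bad colours meet the bound in
  \<open>not_too_bad\<close>.\<close>

lemma no_bad_quadruple:
  assumes idx: "p \<in> {1..r}" "q \<in> {1..r}" "s \<in> {1..r}" "u \<in> {1..r}"
      "p \<noteq> q" "p \<noteq> s" "p \<noteq> u" "q \<noteq> s" "q \<noteq> u" "s \<noteq> u"
    and vs: "x \<in> F p" "y \<in> F q" "z \<in> F s" "w \<in> F u"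
    and N: "N \<subseteq> {1..r+t}" "r - 1 \<le> card N"
      "\<And>e. e \<in> N \<Longrightarrow> \<not> (g e x = g e y \<and> g e x = g e z \<and> g e x = g e w)"
    and c: "c \<in> N" "d \<in> N" "b \<in> N" "c \<noteq> d" "c \<noteq> b" "d \<noteq> b"
    and split: "\<And>e. e \<in> {c, d, b} \<Longrightarrow>
        \<not> (g e x = g e y \<and> g e x = g e z) \<and> \<not> (g e x = g e y \<and> g e x = g e w) \<and>
        \<not> (g e x = g e z \<and> g e x = g e w) \<and> \<not> (g e y = g e z \<and> g e y = g e w)"
  shows False
proof (rule not_too_bad)
  let ?I = "{p, q, s, u}"
  let ?v = "\<lambda>i. if i = p then x else if i = q then y else if i = s then z else w"
  have v: "?v p = x" "?v q = y" "?v s = z" "?v u = w"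
    using idx by auto
  show "\<And>i. i \<in> ?I \<Longrightarrow> ?v i \<in> F i"
    using idx vs by auto
  show "\<exists>j\<in>?I. \<exists>l\<in>?I. g e (?v j) \<noteq> g e (?v l)" if "e \<in> N" for e
    using N(3)[OF that] idx by auto
  show "bad ?I ?v e" if "e \<in> {c, d, b}" for e
    unfolding bad_def
  proof
    fix i
    consider "i \<noteq> p" "i \<noteq> q" "i \<noteq> s" | "i \<noteq> p" "i \<noteq> q" "i \<noteq> u" | "i \<noteq> p" "i \<noteq> s" "i \<noteq> u"
      | "i \<noteq> q" "i \<noteq> s" "i \<noteq> u"
      using idx by metis
    then show "\<exists>j\<in>?I - {i}. \<exists>l\<in>?I - {i}. g e (?v j) \<noteq> g e (?v l)"
    proof cases
      case 1
      then have "g e (?v p) \<noteq> g e (?v q) \<or> g e (?v p) \<noteq> g e (?v s)"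
        using split[OF that] v by metis
      then show ?thesis using 1 by blast
    next
      case 2
      then have "g e (?v p) \<noteq> g e (?v q) \<or> g e (?v p) \<noteq> g e (?v u)"
        using split[OF that] v by metis
      then show ?thesis using 2 by blast
    next
      case 3
      then have "g e (?v p) \<noteq> g e (?v s) \<or> g e (?v p) \<noteq> g e (?v u)"
        using split[OF that] v by metis
      then show ?thesis using 3 by blast
    next
      case 4
      then have "g e (?v q) \<noteq> g e (?v s) \<or> g e (?v q) \<noteq> g e (?v u)"
        using split[OF that] v by metis
      then show ?thesis using 4 by blast
    qed
  qed
  show "card ?I \<le> card {c, d, b} + 1"
    using idx c by simp
  show "?I \<subseteq> {1..r}"
    using idx by blast
  show "{c, d, b} \<subseteq> N"
    using c by blast
qed (fact N)+

section \<open>Far vertices and the contradiction for \<open>r = 3\<close> and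
  \<open>r \<ge> 4\<close>\<close>

text \<open>Vertices of different parts that are not far agree in at least
  \<open>t + 1 \<ge> r\<close> colours. A vertex avoiding their common components in
  \<open>r\<close> of these is far from both and lies in a different part from at least one.\<close>

lemma far_pair:
  "\<exists>p\<in>{1..r}. \<exists>q\<in>{1..r}. \<exists>v\<in>F p. \<exists>y\<in>F q. \<exists>K\<subseteq>{1..r+t}.
     p \<noteq> q \<and> card K = r \<and> (\<forall>c\<in>K. g c v \<noteq> g c y)"
proof (rule ccontr)
  assume no: "\<not> ?thesis"
  have near: False
    if "p \<in> {1..r}" "q \<in> {1..r}" "p \<noteq> q" "v \<in> F p" "y \<in> F q"
      "K \<subseteq> {1..r+t}" "r \<le> card K" "\<forall>c\<in>K. g c v \<noteq> g c y" for p q v y K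
  proof -
    obtain K' where "K' \<subseteq> K" "card K' = r"
      using \<open>r \<le> card K\<close> by (meson obtain_subset_with_card_n)
    then have "K' \<subseteq> {1..r+t}" "card K' = r" "\<forall>c\<in>K'. g c v \<noteq> g c y"
      using that by auto
    then show False
      using no that(1-5) by blast
  qed
  have part: "1 \<in> {1..r}" "2 \<in> {1..r}" and color: "1 \<in> {1..r+t}"
    using r_ge_3 by auto
  obtain v where v: "v \<in> F 1"
    using new_value_2[OF part(1) color] by blast
  obtain y where y: "y \<in> F 2"
    using new_value_2[OF part(2) color] by blast
  define D where "D = {c\<in>{1..r+t}. g c v = g c y}"
  have "card D + card {c\<in>{1..r+t}. g c v \<noteq> g c y} = r + t"
    unfolding D_def by (rule card_filter_complement)
  moreover have "card {c\<in>{1..r+t}. g c v \<noteq> g c y} < r"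
    using near[OF part _ v y, of "{c\<in>{1..r+t}. g c v \<noteq> g c y}"] by fastforce
  ultimately have "r \<le> card D"
    using r_le_t by simp
  then obtain D' where D': "D' \<subseteq> D" "card D' = r" "finite D'"
    by (meson obtain_subset_with_card_n)
  have "card ((\<lambda>c. (c, g c v)) ` D') \<le> t + 1"
    using card_image_le[OF D'(3), of "\<lambda>c. (c, g c v)"] D'(2) r_le_t by linarith
  then obtain i x where ix: "i \<in> {1..r}" "x \<in> F i"
    and x: "\<forall>c\<in>{1..r+t}. (c, g c x) \<notin> (\<lambda>c. (c, g c v)) ` D'"
    using uncovered[of "(\<lambda>c. (c, g c v)) ` D'"] D'(3) by blast
  have far: "\<forall>c\<in>D'. g c v \<noteq> g c x" "\<forall>c\<in>D'. g c y \<noteq> g c x" and sub: "D' \<subseteq> {1..r+t}"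
    using x D'(1) unfolding D_def by (force simp: image_iff)+
  show False
  proof (cases "i = 1")
    case True
    then show False
      using near[OF part(2) ix(1) _ y ix(2) sub _ far(2)] D'(2) by simp
  next
    case False
    then show False
      using near[OF part(1) ix(1) _ v ix(2) sub _ far(1)] D'(2) by simp
  qed
qed

text \<open>On the two colours \<open>c\<close>, \<open>d\<close>, a vertex of the third part with a new value in one of them is forced
  to agree with \<open>y\<close> in the other, and then so is a vertex of part \<open>q\<close>.\<close>

lemma no_spread_triple:
  assumes idx: "p \<in> {1..r}" "q \<in> {1..r}" "p \<noteq> q" and r: "r = 3"
    and vs: "v \<in> F p" "x \<in> F p" "y \<in> F q"
    and c: "c \<in> {1..r+t}" "d \<in> {1..r+t}" "c \<noteq> d"
    and three: "\<And>e. e \<in> {c, d} \<Longrightarrow> g e v \<noteq> g e y \<and> g e v \<noteq> g e x \<and> g e y \<noteq> g e x"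
  shows False
proof -
  have "card ({1..r} - {p, q}) = 1"
    using idx r by (simp add: card_Diff_subset)
  then obtain s where "s \<in> {1..r} - {p, q}"
    by (metis card_1_singletonE singletonI)
  then have s: "s \<in> {1..r}" "p \<noteq> s" "q \<noteq> s"
    by auto
  have agree: "g d a = g d b \<or> g d a = g d z \<or> g d b = g d z"
    if "a \<in> F p" "b \<in> F q" "z \<in> F s" "g c a \<noteq> g c b" "g c a \<noteq> g c z" "g c b \<noteq> g c z" for a b z
    using no_bad_triple[OF idx(1,2) s(1) idx(3) s(2,3) that(1-3) r c] that(4-) by blast
  obtain z where z: "z \<in> F s" "g c z \<noteq> g c v" "g c z \<noteq> g c x" "g c z \<noteq> g c y"
    using new_value_4[OF s(1) c(1)] by metis
  \<comment> \<open>Each of \<open>v\<close> and \<open>x\<close>, taken with \<open>y\<close> and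
    \<open>z\<close>, forces an agreement in \<open>d\<close>; as \<open>v\<close>,
    \<open>x\<close>, \<open>y\<close> differ there, it must be between \<open>y\<close> and
    \<open>z\<close>.\<close>
  have z_d: "g d z = g d y"
    using agree[of v y z] agree[of x y z] vs z three by (metis insertCI)
  obtain z' where z': "z' \<in> F s" "g d z' \<noteq> g d v" "g d z' \<noteq> g d x" "g d z' \<noteq> g d y"
    using new_value_4[OF s(1) c(2)] by metis
  have z'_c: "g c z' = g c y"
    using agree[of v y z'] agree[of x y z'] vs z' three by (metis insertCI)
  obtain w where w: "w \<in> F q" "g c w \<noteq> g c v" "g c w \<noteq> g c x" "g c w \<noteq> g c y" "g c w \<noteq> g c z"
    using new_value_4[OF idx(2) c(1)] by metis
  have "g d w = g d y"
    using agree[of v w z] agree[of x w z] vs z w z_d three by (metis insertCI)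
  \<comment> \<open>In \<open>c\<close> the vertex \<open>z'\<close> has the value of
    \<open>y\<close>, in \<open>d\<close> the vertex \<open>w\<close> has it; so \<open>v\<close>,
    \<open>w\<close>, \<open>z'\<close> pairwise differ in both colours.\<close>
  then show False
    using agree[of v w z'] vs z' z'_c w three by (metis insertCI)
qed

text \<open>The components of a far pair in two colours number at most \<open>4 \<le> t + 1\<close>,
  so some \<open>x\<close> avoids them. It completes a forbidden triple or shares a part with
  \<open>v\<close> or \<open>y\<close> and falls under \<open>no_spread_triple\<close>.\<close>

lemma contradiction_3:
  assumes r: "r = 3"
  shows False
proof -
  obtain p q v y K where pq: "p \<in> {1..r}" "q \<in> {1..r}" "p \<noteq> q" and vy: "v \<in> F p" "y \<in> F q"
    and K: "K \<subseteq> {1..r+t}" "card K = r" "\<forall>c\<in>K. g c v \<noteq> g c y"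
    using far_pair by blast
  obtain c d where "c \<in> K" "d \<in> K" "c \<noteq> d"
    using K(2) r by (metis card_3_iff insertCI)
  then have c: "c \<in> {1..r+t}" "d \<in> {1..r+t}" "c \<noteq> d" and vy': "g c v \<noteq> g c y" "g d v \<noteq> g d y"
    using K by auto
  let ?S = "{(c, g c v), (c, g c y), (d, g d v), (d, g d y)}"
  have "card ?S \<le> t + 1"
    using r r_le_t by (simp add: card_insert_if)
  then obtain i x where ix: "i \<in> {1..r}" "x \<in> F i"
    and x: "\<forall>e\<in>{1..r+t}. (e, g e x) \<notin> ?S"
    using uncovered[of ?S] by blast
  have x': "g c v \<noteq> g c x" "g c y \<noteq> g c x" "g d v \<noteq> g d x" "g d y \<noteq> g d x"
    using bspec[OF x c(1)] bspec[OF x c(2)] by auto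
  consider "i = p" | "i = q" | "i \<noteq> p" "i \<noteq> q"
    by blast
  then show False
  proof cases
    case 1
    show False
      by (rule no_spread_triple[OF pq r vy(1) _ vy(2) c, of x]) (use 1 ix vy' x' in auto)
  next
    case 2
    show False
      by (rule no_spread_triple[OF pq(2,1) pq(3)[symmetric] r vy(2) _ vy(1) c, of x])
        (use 2 ix vy' x' in auto)
  next
    case 3
    show False
      by (rule no_bad_triple[OF pq(1,2) ix(1) pq(3) _ _ vy ix(2) r c]) (use 3 vy' x' in auto)
  qed
qed

text \<open>The vertex \<open>z\<close> is the centre of parts \<open>s\<close> and \<open>u\<close>, whose vertices deviate from it at most once on
  (most of) \<open>K\<close>. A vertex \<open>x\<close> far from \<open>z\<close> lets deviations in parts \<open>u\<close>, \<open>s\<close>, \<open>q\<close> make three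
  different colours bad.\<close>

lemma no_far_vertex:
  assumes idx: "p \<in> {1..r}" "q \<in> {1..r}" "s \<in> {1..r}" "u \<in> {1..r}"
      "p \<noteq> q" "p \<noteq> s" "p \<noteq> u" "q \<noteq> s" "q \<noteq> u" "s \<noteq> u"
    and x: "x \<in> F p"
    and K: "K \<subseteq> {1..r+t}" "card K = r" and c: "c \<in> K" "d \<in> K" "c \<noteq> d"
    and ab: "a \<in> K - {c, d}" "b \<in> K - {c, d}" "a \<noteq> b"
    and far: "\<And>e. e \<in> K - {c} \<Longrightarrow> g e x \<noteq> g e z"
    and near_u: "\<And>w e e'. w \<in> F u \<Longrightarrow> e \<in> K - {c} \<Longrightarrow> e' \<in> K - {c} \<Longrightarrow> e \<noteq> e' \<Longrightarrow>
        g e w \<noteq> g e z \<Longrightarrow> g e' w = g e' z"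
    and near_s: "\<And>w e e'. w \<in> F s \<Longrightarrow> e \<in> K - {c, d} \<Longrightarrow> e' \<in> K - {c, d} \<Longrightarrow> e \<noteq> e' \<Longrightarrow>
        g e w \<noteq> g e z \<Longrightarrow> g e' w = g e' z"
  shows False
proof -
  obtain w where w: "w \<in> F u" "g a w \<noteq> g a x" "g a w \<noteq> g a z"
    using new_value_2[OF idx(4)] ab(1) K(1) by blast
  obtain z' where z': "z' \<in> F s" "g b z' \<noteq> g b x" "g b z' \<noteq> g b z"
    using new_value_2[OF idx(3)] ab(2) K(1) by blast
  obtain y where y: "y \<in> F q" "g d y \<noteq> g d x" "g d y \<noteq> g d z"
    using new_value_2[OF idx(2)] c(2) K(1) by blast
  have w_eq: "g e w = g e z" if "e \<in> K - {c}" "e \<noteq> a" for e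
    using near_u[OF w(1), of a e] that ab w(3) by auto
  have z'_eq: "g a z' = g a z"
    using near_s[OF z'(1), of b a] ab z'(3) by auto
  have fin: "finite K"
    using K(1) finite_subset by blast
  show False
  proof (rule no_bad_quadruple[OF idx x y(1) z'(1) w(1), of "K - {c}" a d b])
    show "r - 1 \<le> card (K - {c})"
      using K(2) c(1) fin by simp
    show "\<not> (g e x = g e y \<and> g e x = g e z' \<and> g e x = g e w)" if "e \<in> K - {c}" for e
      using w_eq[OF that] far[OF that] w(2) by metis
    \<comment> \<open>In \<open>a\<close> and \<open>b\<close> the vertices \<open>x\<close>,
      \<open>z'\<close>, \<open>w\<close> pairwise differ, in \<open>d\<close> the vertices
      \<open>x\<close>, \<open>y\<close>, \<open>w\<close>; any three of the four vertices include
      two of these.\<close>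
    fix e assume "e \<in> {a, d, b}"
    moreover have "g a x \<noteq> g a z" "g d x \<noteq> g d z" "g b x \<noteq> g b z" "g d w = g d z" "g b w = g b z"
      using far w_eq ab c by auto
    ultimately show "\<not> (g e x = g e y \<and> g e x = g e z') \<and> \<not> (g e x = g e y \<and> g e x = g e w) \<and>
        \<not> (g e x = g e z' \<and> g e x = g e w) \<and> \<not> (g e y = g e z' \<and> g e y = g e w)"
      using w z' y z'_eq by (elim insertE) auto
  qed (use K ab c in auto)
qed

text \<open>A far pair and two further vertices have at most two bad colours on \<open>K\<close>.
  New values of \<open>z\<close> in \<open>c\<close> and of \<open>z'\<close> in \<open>d\<close>
  use these up, so vertices outside parts \<open>p\<close>, \<open>q\<close> stay close to
  \<open>z\<close>. Some \<open>x\<close> avoids the \<open>r - 1\<close> components of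
  \<open>z\<close> in \<open>K - {c}\<close>, yet no part can contain it.\<close>

lemma contradiction_ge_4:
  assumes r: "4 \<le> r"
  shows False
proof -
  obtain p q v y K where pq: "p \<in> {1..r}" "q \<in> {1..r}" "p \<noteq> q" and vy: "v \<in> F p" "y \<in> F q"
    and K: "K \<subseteq> {1..r+t}" "card K = r" "\<forall>c\<in>K. g c v \<noteq> g c y"
    using far_pair by blast
  have fin: "finite K"
    using K(1) finite_subset by blast
  have two: "\<exists>a\<in>A. \<exists>b\<in>A. a \<noteq> b" if "2 \<le> card A" for A :: "nat set"
    using obtain_subset_with_card_n[OF that] by (metis card_2_iff insertCI subset_iff)
  have "2 \<le> card ({1..r} - {p, q})"
    using pq r by (simp add: card_Diff_subset)
  then obtain s u where su: "s \<in> {1..r}" "u \<in> {1..r}" "p \<noteq> s" "p \<noteq> u" "q \<noteq> s" "q \<noteq> u" "s \<noteq> u"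
    using two by blast
  obtain c d where c: "c \<in> K" "d \<in> K" "c \<noteq> d"
    using two[of K] K(2) r by auto
  have "2 \<le> card (K - {c, d})"
    using c K(2) r fin by (simp add: card_Diff_subset)
  then obtain a b where ab: "a \<in> K - {c, d}" "b \<in> K - {c, d}" "a \<noteq> b"
    using two by blast
  obtain z where z: "z \<in> F s" "g c z \<noteq> g c v" "g c z \<noteq> g c y"
    using new_value_2[OF su(1)] c(1) K(1) by blast
  obtain z' where z': "z' \<in> F u" "g d z' \<noteq> g d v" "g d z' \<noteq> g d y"
    using new_value_2[OF su(2)] c(2) K(1) by blast
  \<comment> \<open>As \<open>v\<close> and \<open>y\<close> differ on \<open>K\<close>, no three of
    \<open>v\<close>, \<open>y\<close>, \<open>w\<close>, \<open>w'\<close> agree in such a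
    colour.\<close>
  have few: False
    if ij: "i \<in> {1..r}" "j \<in> {1..r}" "p \<noteq> i" "p \<noteq> j" "q \<noteq> i" "q \<noteq> j" "i \<noteq> j"
      and ws: "w \<in> F i" "w' \<in> F j"
      and e: "e1 \<in> K" "e2 \<in> K" "e3 \<in> K" "e1 \<noteq> e2" "e1 \<noteq> e3" "e2 \<noteq> e3"
      and bad: "\<forall>e\<in>{e1, e2, e3}. g e w \<noteq> g e w' \<or> g e w \<noteq> g e v \<and> g e w \<noteq> g e y"
    for i j w w' e1 e2 e3
  proof (rule no_bad_quadruple[OF pq(1,2) ij(1,2) pq(3) ij(3-7) vy ws K(1) _ _ e])
    show "\<not> (g e v = g e y \<and> g e v = g e w \<and> g e v = g e w')" if "e \<in> K" for e
      using K(3) that by auto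
    fix e assume "e \<in> {e1, e2, e3}"
    then have "g e v \<noteq> g e y" "g e w \<noteq> g e w' \<or> g e w \<noteq> g e v \<and> g e w \<noteq> g e y"
      using bad K(3) e by auto
    then show "\<not> (g e v = g e y \<and> g e v = g e w) \<and> \<not> (g e v = g e y \<and> g e v = g e w') \<and>
        \<not> (g e v = g e w \<and> g e v = g e w') \<and> \<not> (g e y = g e w \<and> g e y = g e w')"
      by auto
  qed (use K(2) in simp)
  \<comment> \<open>Two deviations of \<open>w\<close> from \<open>z\<close> would join
    \<open>c\<close>, where \<open>z\<close> has a new value, as a third bad colour.\<close>
  have near: "g e' w = g e' z"
    if "j \<in> {1..r}" "p \<noteq> j" "q \<noteq> j" "s \<noteq> j" "w \<in> F j" "e \<in> K - {c}" "e' \<in> K - {c}" "e \<noteq> e'"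
      "g e w \<noteq> g e z" for j w e e'
  proof (rule ccontr)
    assume "g e' w \<noteq> g e' z"
    then show False
      by (intro few[OF su(1) that(1) su(3) that(2) su(5) that(3,4) z(1) that(5), of c e e'])
        (use that(6-) z(2,3) c in auto)
  qed
  have z_z': "g e z = g e z'" if "e \<in> K - {c, d}" for e
  proof (rule ccontr)
    assume "g e z \<noteq> g e z'"
    then show False
      by (intro few[OF su z(1) z'(1), of c d e]) (use that z(2,3) z'(2,3) c in auto)
  qed
  \<comment> \<open>As \<open>w\<close> and \<open>z\<close> lie in the same part, \<open>z'\<close>
    stands in for \<open>z\<close>, and \<open>d\<close> for \<open>c\<close>.\<close>
  have near_s: "g e' w = g e' z"
    if "w \<in> F s" "e \<in> K - {c, d}" "e' \<in> K - {c, d}" "e \<noteq> e'" "g e w \<noteq> g e z" for w e e'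
  proof (rule ccontr)
    assume "g e' w \<noteq> g e' z"
    then show False
      by (intro few[OF su that(1) z'(1), of d e e']) (use that(2-) z_z' z'(2,3) c in auto)
  qed
  let ?S = "(\<lambda>e. (e, g e z)) ` (K - {c})"
  have "card ?S \<le> t + 1"
    using card_image_le[of "K - {c}" "\<lambda>e. (e, g e z)"] fin card_Diff1_le[of K c] K(2) r_le_t by simp
  then obtain i x where ix: "i \<in> {1..r}" "x \<in> F i"
    and x: "\<forall>e\<in>{1..r+t}. (e, g e x) \<notin> ?S"
    using uncovered[of ?S] fin by blast
  have far: "g e x \<noteq> g e z" if "e \<in> K - {c}" for e
    using x that K(1) by force
  consider "i = p" | "i = q" | "i = s" | "i \<noteq> p" "i \<noteq> q" "i \<noteq> s"
    by blast
  then show False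
  proof cases
    case 1
    show False
      by (rule no_far_vertex[OF pq(1,2) su(1,2) pq(3) su(3-7) _ K(1,2) c ab far
            near[OF su(2,4,6,7)] near_s]) (use 1 ix in auto)
  next
    case 2
    show False
      by (rule no_far_vertex[OF pq(2,1) su(1,2) pq(3)[symmetric] su(5,6,3,4,7) _ K(1,2) c ab far
            near[OF su(2,4,6,7)] near_s]) (use 2 ix in auto)
  next
    case 3
    then show False
      using near_s[of x a b] ix ab far by auto
  next
    case 4
    then show False
      using near[OF ix(1) _ _ _ ix(2), of a b] ab far by auto
  qed
qed

lemma contradiction: False
  using contradiction_3 contradiction_ge_4 r_ge_3 by fastforce

end

section \<open>Connectedness and components\<close>

text \<open>Vertices in consecutive intersections turn an edge sequence into a walk with one edge
  per step; the empty walk is \<open>x = y\<close>.\<close>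

lemma joined_iff_rtrancl:
  "joined G x y \<longleftrightarrow> (x, y) \<in> {(a, b). \<exists>e\<in>edges G. a \<in> e \<and> b \<in> e}\<^sup>*"
  (is "_ \<longleftrightarrow> _ \<in> ?R\<^sup>*")
proof
  have path: "(x, y) \<in> ?R\<^sup>*"
    if "es \<noteq> []" "set es \<subseteq> edges G" "x \<in> hd es" "y \<in> last es"
      "successively (\<lambda>e e'. e \<inter> e' \<noteq> {}) es" for es
    using that
  proof (induction es arbitrary: x)
    case (Cons e es)
    show ?case
    proof (cases es)
      case Nil
      then show ?thesis using Cons.prems by auto
    next
      case (Cons e' es')
      then obtain w where "w \<in> e" "w \<in> e'"
        using Cons.prems by auto
      then have "(x, w) \<in> ?R" "(w, y) \<in> ?R\<^sup>*"
        using Cons.prems Cons.IH[of w] \<open>es = e' # es'\<close> by auto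
      then show ?thesis
        by (rule converse_rtrancl_into_rtrancl)
    qed
  qed simp
  show "(x, y) \<in> ?R\<^sup>*" if "joined G x y"
    using that path unfolding joined_def by auto
  show "joined G x y" if "(x, y) \<in> ?R\<^sup>*"
    using that
  proof (induction rule: rtrancl_induct)
    case base
    show ?case by (simp add: joined_def)
  next
    case (step y z)
    then obtain e where e: "e \<in> edges G" "y \<in> e" "z \<in> e"
      by blast
    from step.IH consider "x = y" | es where "es \<noteq> []" "set es \<subseteq> edges G" "x \<in> hd es" "y \<in> last es"
        "successively (\<lambda>e e'. e \<inter> e' \<noteq> {}) es"
      unfolding joined_def by blast
    then show ?case
    proof cases
      case 1
      then show ?thesis
        unfolding joined_def using e by (intro disjI2 exI[of _ "[e]"]) auto
    next
      case 2
      then show ?thesis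
        unfolding joined_def using e
        by (intro disjI2 exI[of _ "es @ [e]"]) (auto simp: successively_append_iff)
    qed
  qed
qed

lemma joined_refl [simp]: "joined G x x"
  by (simp add: joined_def)

lemma joined_sym: "joined G x y \<Longrightarrow> joined G y x"
  unfolding joined_iff_rtrancl by (rule symD[OF sym_rtrancl]) (auto simp: sym_def)

lemma joined_trans: "joined G x y \<Longrightarrow> joined G y z \<Longrightarrow> joined G x z"
  unfolding joined_iff_rtrancl by (rule rtrancl_trans)

lemma joined_edge: "e \<in> edges G \<Longrightarrow> x \<in> e \<Longrightarrow> y \<in> e \<Longrightarrow> joined G x y"
  unfolding joined_iff_rtrancl by (rule r_into_rtrancl) auto

lemma joined_mono: "edges G \<subseteq> edges G' \<Longrightarrow> joined G x y \<Longrightarrow> joined G' x y"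
  unfolding joined_iff_rtrancl by (erule rtrancl_mono[THEN subsetD, rotated]) auto

lemma joined_invariant:
  assumes "joined G x y" "\<And>e a b. e \<in> edges G \<Longrightarrow> a \<in> e \<Longrightarrow> b \<in> e \<Longrightarrow> h a = h b"
  shows "h x = h y"
  using assms(1) unfolding joined_iff_rtrancl
proof (induction rule: rtrancl_induct)
  case (step y z)
  then show ?case
    using assms(2)[of _ y z] by auto
qed simp

text \<open>An edge met on a walk from \<open>x\<close> lies in \<open>W\<close>, so the walk stays
  inside. A connected extension contains \<open>x\<close>, so all its vertices are reachable from
  \<open>x\<close>.\<close>

lemma component_of_vertex:
  assumes x: "x \<in> verts G"
    and sub: "\<And>e. e \<in> edges G \<Longrightarrow> e \<subseteq> verts G"
  defines "W \<equiv> {y \<in> verts G. joined G x y}"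
  shows "component G (Hypergraph W {e \<in> edges G. e \<subseteq> W})"
    (is "component G ?C")
  unfolding component_def
proof (intro conjI allI impI)
  show "subhypergraph ?C G"
    by (auto simp: subhypergraph_def W_def)
  have joined_C: "joined ?C x y" if "joined G x y" for y
    using that unfolding joined_iff_rtrancl[of G]
  proof (induction rule: rtrancl_induct)
    case base
    show ?case by simp
  next
    case (step y z)
    then obtain e where e: "e \<in> edges G" "y \<in> e" "z \<in> e"
      by blast
    have "joined G x a" if "a \<in> e" for a
      using joined_trans[OF _ joined_edge[OF e(1,2) that]] step.hyps(1)
      unfolding joined_iff_rtrancl .
    then have "e \<subseteq> W"
      using sub[OF e(1)] by (auto simp: W_def)
    then show ?case
      using step.IH e joined_edge[of e ?C y z] joined_trans by auto
  qed
  then show "connected_hypergraph ?C"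
    unfolding connected_hypergraph_def W_def using joined_sym joined_trans
    by (metis (no_types, lifting) hypergraph.sel(1) mem_Collect_eq)
  fix D
  assume D: "subhypergraph D G \<and> connected_hypergraph D \<and> subhypergraph ?C D"
  then have "x \<in> verts D"
    using x by (auto simp: subhypergraph_def W_def)
  have "verts D \<subseteq> W"
  proof
    fix y assume "y \<in> verts D"
    then have "joined D x y"
      using D \<open>x \<in> verts D\<close> by (auto simp: connected_hypergraph_def)
    then have "joined G x y"
      using D joined_mono by (auto simp: subhypergraph_def)
    then show "y \<in> W"
      using D \<open>y \<in> verts D\<close> by (auto simp: W_def subhypergraph_def)
  qed
  then have "verts D = W"
    using D by (auto simp: subhypergraph_def)
  then show "D = ?C"
    using D by (intro hypergraph.expand) (auto simp: subhypergraph_def)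
qed

section \<open>The upper bound for hypergraphs\<close>

text \<open>The vertex sets \<open>g c x\<close> represent the components. The colour of an edge
  gives \<open>agreement\<close>, the spanning property \<open>transfer\<close>, and the lack of a
  cover \<open>uncovered\<close>.\<close>

lemma coverable_spanning_coloring:
  assumes r: "3 \<le> r" "r \<le> t"
    and H: "complete_partite r H" and f: "spanning_coloring H (r + t) f"
  shows "coverable H (r + t) f (t + 1)"
proof (rule ccontr)
  assume not_cov: "\<not> ?thesis"
  obtain V where V: "verts H = (\<Union>i\<in>{1..r}. V i)"
    "edges H = {v ` {1..r} | v. \<forall>i\<in>{1..r}. v i \<in> V i}"
    using H unfolding complete_partite_def by (elim exE conjE) (rule that)
  define G where "G = color_class H f"
  have verts_G: "verts (G c) = verts H" for c
    by (simp add: G_def color_class_def)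
  have edges_G: "edges (G c) = {e \<in> edges H. f e = c}" for c
    by (simp add: G_def color_class_def)
  have edgeE: thesis
    if "e \<in> edges H" "\<And>v. e = v ` {1..r} \<Longrightarrow> \<forall>i\<in>{1..r}. v i \<in> V i \<Longrightarrow> thesis" for e thesis
    using that unfolding V(2) by (auto simp del: One_nat_def)
  have edge_sub: "e \<subseteq> verts H" if "e \<in> edges H" for e
    using that V by auto
  define g where "g c x = {y \<in> verts H. joined (G c) x y}" for c x
  have g_eq: "g c x = g c y" if "joined (G c) x y" for c x y
  proof -
    have "joined (G c) x z \<longleftrightarrow> joined (G c) y z" for z
      using joined_trans[OF joined_sym[OF that]] joined_trans[OF that] by blast
    then show ?thesis
      by (simp add: g_def)
  qed
  interpret uncoverable_parts r t V g
  proof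
    fix v assume v: "\<And>i. i \<in> {1..r} \<Longrightarrow> v i \<in> V i"
    then have e: "v ` {1..r} \<in> edges H"
      using V by blast
    have "g (f (v ` {1..r})) (v i) = g (f (v ` {1..r})) (v j)" if "i \<in> {1..r}" "j \<in> {1..r}" for i j
      using that e by (intro g_eq joined_edge[of "v ` {1..r}"]) (auto simp: edges_G)
    then show "\<exists>c\<in>{1..r+t}. \<forall>i\<in>{1..r}. \<forall>j\<in>{1..r}. g c (v i) = g c (v j)"
      using f e unfolding spanning_coloring_def by blast
  next
    fix i j c x
    assume ij: "i \<in> {1..r}" "j \<in> {1..r}" "c \<in> {1..r+t}" "x \<in> V i"
    then have "x \<in> verts H"
      using V by blast
    then obtain e where e: "e \<in> edges H" "x \<in> e" "f e = c"
      using f ij(3) unfolding spanning_coloring_def by blast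
    obtain v where v: "e = v ` {1..r}" "\<forall>i\<in>{1..r}. v i \<in> V i"
      by (rule edgeE[OF e(1)])
    have "g c (v j) = g c x"
      using e v ij by (intro g_eq joined_edge[of e]) (auto simp: edges_G)
    then show "\<exists>y\<in>V j. g c y = g c x"
      using v ij by blast
  next
    fix S :: "(nat \<times> 'a set) set"
    assume S: "finite S" "card S \<le> t + 1"
    define comp where "comp = (\<lambda>(c, W). Hypergraph W {e \<in> edges (G c). e \<subseteq> W})"
    \<comment> \<open>Only the pairs that name a monochromatic component are kept.\<close>
    define S' where "S' = {(c, W) \<in> S. c \<in> {1..r+t} \<and> (\<exists>x\<in>verts H. W = g c x)}"
    have "S' \<subseteq> S"
      by (auto simp: S'_def)
    then have fin: "finite S'" and card_S': "card S' \<le> t + 1"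
      using S finite_subset card_mono le_trans by metis+
    have "mono_component H (r + t) f (comp cW)" if cW: "cW \<in> S'" for cW
    proof -
      obtain c x where c: "cW = (c, g c x)" "c \<in> {1..r+t}" "x \<in> verts H"
        using cW unfolding S'_def by blast
      have "component (G c) (comp cW)"
        using component_of_vertex[of x "G c"] c(1,3) edge_sub
        by (auto simp: comp_def g_def verts_G edges_G)
      then show ?thesis
        using c(2) by (auto simp: mono_component_def G_def)
    qed
    moreover have "finite (comp ` S')" "card (comp ` S') \<le> t + 1"
      using fin card_S' card_image_le[OF fin, of comp] by auto
    ultimately have "\<not> verts H \<subseteq> (\<Union>C\<in>comp ` S'. verts C)"
      using not_cov unfolding coverable_def by blast
    then obtain x where x: "x \<in> verts H" "\<And>cW. cW \<in> S' \<Longrightarrow> x \<notin> verts (comp cW)"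
      by blast
    have "(c, g c x) \<notin> S" if "c \<in> {1..r+t}" for c
    proof
      assume "(c, g c x) \<in> S"
      then have "(c, g c x) \<in> S'"
        using that x(1) by (auto simp: S'_def)
      then show False
        using x by (force simp: comp_def g_def)
    qed
    then show "\<exists>i\<in>{1..r}. \<exists>x\<in>V i. \<forall>c\<in>{1..r+t}. (c, g c x) \<notin> S"
      using x(1) V by blast
  qed (use r in auto)
  show False
    by (rule contradiction)
qed

section \<open>The construction for the lower bound\<close>

definition vectors :: "nat \<Rightarrow> nat \<Rightarrow> nat \<Rightarrow> (nat \<Rightarrow> nat) set" where
  "vectors k t m = {x \<in> {1..k} \<rightarrow>\<^sub>E {..t}. card {c\<in>{1..k}. x c \<noteq> 0} \<le> m}"

text \<open>The colour labels make the colouring of the lower bound spanning: an edge with a common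
  coordinate \<open>c\<close> receives the colour \<open>c\<close> as soon as all its vertices but one are labelled \<open>c\<close>.\<close>

lemma labelled_parts_exist:
  fixes r t :: nat
  shows "\<exists>(V :: nat \<Rightarrow> 'v::infinite set) coord label.
    (\<forall>i\<in>{1..r}. finite (V i)) \<and> disjoint_family_on V {1..r} \<and>
    (\<forall>i\<in>{1..r}. \<forall>v\<in>V i. coord v \<in> vectors (r + t) t (if i = 1 then t else 1)) \<and>
    (\<forall>i\<in>{1..r}. \<forall>x\<in>vectors (r + t) t (if i = 1 then t else 1). \<forall>c\<in>{1..r+t}.
       \<exists>v\<in>V i. coord v = x \<and> label v = (c :: nat))"
proof -
  \<comment> \<open>The tag \<open>i\<close> keeps the parts disjoint. The finite union embeds into
    the infinite vertex type; coordinates and labels are read off by decoding.\<close>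
  define W where "W i = {i} \<times> vectors (r + t) t (if i = 1 then t else 1) \<times> {1..r+t}" for i :: nat
  have fin_vec: "finite (vectors k t m)" for k m
    unfolding vectors_def by (rule finite_subset[OF _ finite_PiE[of "{1..k}" "\<lambda>_. {..t}"]]) auto
  then have fin: "finite (W i)" for i
    by (simp add: W_def)
  then have fin_Un: "finite (\<Union>i\<in>{1..r}. W i)"
    by simp
  obtain B :: "'v set" where "finite B" "card B = card (\<Union>i\<in>{1..r}. W i)"
    using infinite_arbitrarily_large[OF infinite_UNIV] by metis
  then obtain h where "bij_betw h (\<Union>i\<in>{1..r}. W i) B"
    using finite_same_card_bij[OF fin_Un] by metis
  then have inj: "inj_on h (\<Union>i\<in>{1..r}. W i)"
    by (rule bij_betw_imp_inj_on)
  define d where "d = inv_into (\<Union>i\<in>{1..r}. W i) h"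
  have d: "d (h w) = w" if "i \<in> {1..r}" "w \<in> W i" for i w
    unfolding d_def by (rule inv_into_f_f[OF inj]) (use that in blast)
  show ?thesis
  proof (intro exI[of _ "\<lambda>i. h ` W i"] exI[of _ "\<lambda>v. fst (snd (d v))"]
      exI[of _ "\<lambda>v. snd (snd (d v))"] conjI)
    show "disjoint_family_on (\<lambda>i. h ` W i) {1..r}"
      unfolding disjoint_family_on_def
    proof (intro ballI impI, rule ccontr)
      fix i j assume ij: "i \<in> {1..r}" "j \<in> {1..r}" "i \<noteq> j" and "h ` W i \<inter> h ` W j \<noteq> {}"
      then obtain a b where "a \<in> W i" "b \<in> W j" "h a = h b"
        by blast
      then have "a = b"
        using d ij by metis
      then show False
        using \<open>a \<in> W i\<close> \<open>b \<in> W j\<close> ij by (auto simp: W_def)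
    qed
    show "\<forall>i\<in>{1..r}. \<forall>v\<in>h ` W i. fst (snd (d v)) \<in> vectors (r + t) t (if i = 1 then t else 1)"
    proof (intro ballI)
      fix i v assume "i \<in> {1..r}" "v \<in> h ` W i"
      then obtain w where "w \<in> W i" "d v = w"
        using d by blast
      then show "fst (snd (d v)) \<in> vectors (r + t) t (if i = 1 then t else 1)"
        by (auto simp: W_def)
    qed
    show "\<forall>i\<in>{1..r}. \<forall>x\<in>vectors (r + t) t (if i = 1 then t else 1). \<forall>c\<in>{1..r+t}.
        \<exists>v\<in>h ` W i. fst (snd (d v)) = x \<and> snd (snd (d v)) = c"
    proof (intro ballI)
      fix i x c assume "i \<in> {1..r}" "x \<in> vectors (r + t) t (if i = 1 then t else 1)" "c \<in> {1..r+t}"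
      then have "(i, x, c) \<in> W i" "i \<in> {1..r}"
        by (auto simp: W_def)
      then show "\<exists>v\<in>h ` W i. fst (snd (d v)) = x \<and> snd (snd (d v)) = c"
        using d by (intro bexI[of _ "h (i, x, c)"]) auto
    qed
  qed (use fin in auto)
qed

lemma unit_vector:
  assumes "c \<in> {1..k}" "a \<le> t" "1 \<le> m"
  shows "(\<lambda>d\<in>{1..k}. if d = c then a else 0) \<in> vectors k t m"
proof -
  have "{d\<in>{1..k}. (\<lambda>d\<in>{1..k}. if d = c then a else 0) d \<noteq> 0} \<subseteq> {c}"
    by auto
  then have "card {d\<in>{1..k}. (\<lambda>d\<in>{1..k}. if d = c then a else 0) d \<noteq> 0} \<le> card {c}"
    by (intro card_mono) auto
  then show ?thesis
    using assms by (auto simp: vectors_def)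
qed

lemma not_coverable_lower:
  assumes r: "3 \<le> r" "1 \<le> t"
  shows "\<exists>(H :: 'v::infinite hypergraph) f.
    finite (verts H) \<and> complete_partite r H \<and> spanning_coloring H (r + t) f \<and>
    \<not> coverable H (r + t) f t"
proof -
  let ?m = "\<lambda>i. if i = 1 then t else 1 :: nat"
  obtain V :: "nat \<Rightarrow> 'v set" and coord label where fin: "\<forall>i\<in>{1..r}. finite (V i)"
    and disj: "disjoint_family_on V {1..r}"
    and coord: "\<forall>i\<in>{1..r}. \<forall>v\<in>V i. coord v \<in> vectors (r + t) t (?m i)"
    and ex: "\<forall>i\<in>{1..r}. \<forall>x\<in>vectors (r + t) t (?m i). \<forall>c\<in>{1..r+t}.
       \<exists>v\<in>V i. coord v = x \<and> label v = (c :: nat)"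
    using labelled_parts_exist[where ?'v = 'v, of r t] by (elim exE conjE) (rule that)
  define H where "H = Hypergraph (\<Union>i\<in>{1..r}. V i) {v ` {1..r} | v. \<forall>i\<in>{1..r}. v i \<in> V i}"
  define common where "common e c \<longleftrightarrow> c \<in> {1..r+t} \<and> (\<forall>a\<in>e. \<forall>b\<in>e. coord a c = coord b c)" for e c
  define labelled where "labelled e c \<longleftrightarrow> (\<exists>x. \<forall>v\<in>e - {x}. label v = c)" for e c
  \<comment> \<open>Any common coordinate may serve as colour, but a labelled one takes
    precedence.\<close>
  define f where "f e = (if \<exists>c. common e c \<and> labelled e c then SOME c. common e c \<and> labelled e c
    else SOME c. common e c)" for e
  have edges_H: "edges H = {v ` {1..r} | v. \<forall>i\<in>{1..r}. v i \<in> V i}"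
    and verts_H: "verts H = (\<Union>i\<in>{1..r}. V i)"
    by (simp_all add: H_def)
  have edgeE: thesis
    if "e \<in> edges H" "\<And>v. e = v ` {1..r} \<Longrightarrow> \<forall>i\<in>{1..r}. v i \<in> V i \<Longrightarrow> thesis" for e thesis
    using that unfolding edges_H by (auto simp del: One_nat_def)
  have inj: "i = j" if "v i = v j" "i \<in> {1..r}" "j \<in> {1..r}" "\<forall>i\<in>{1..r}. v i \<in> V i" for v i j
    using that disj unfolding disjoint_family_on_def by (metis disjoint_iff)
  have ex_common: "\<exists>c. common e c" if e: "e \<in> edges H" for e
  proof -
    obtain v where v: "e = v ` {1..r}" "\<forall>i\<in>{1..r}. v i \<in> V i"
      by (rule edgeE[OF e])
    \<comment> \<open>An edge has at most \<open>t + (r - 1)\<close> nonzero entries in all, fewer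
      than there are coordinates, so some coordinate is zero throughout.\<close>
    define Z where "Z i = {c\<in>{1..r+t}. coord (v i) c \<noteq> 0}" for i
    have card_Z: "card (Z i) \<le> ?m i" if "i \<in> {1..r}" for i
      using coord v(2) that by (auto simp: Z_def vectors_def)
    have "card (\<Union>i\<in>{1..r}. Z i) \<le> (\<Sum>i\<in>{1..r}. card (Z i))"
      by (rule card_UN_le) simp
    also have "\<dots> \<le> (\<Sum>i\<in>{1..r}. ?m i)"
      by (rule sum_mono) (rule card_Z)
    also have "\<dots> = t + (\<Sum>i\<in>{1..r} - {1}. ?m i)"
      using r by (subst sum.remove[of _ 1]) auto
    also have "(\<Sum>i\<in>{1..r} - {1}. ?m i) = (\<Sum>i\<in>{1..r} - {1}. 1)"
      by (rule sum.cong) auto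
    also have "t + \<dots> < card {1..r+t}"
      using r by simp
    finally have "\<not> {1..r+t} \<subseteq> (\<Union>i\<in>{1..r}. Z i)"
      using card_mono[of "\<Union>i\<in>{1..r}. Z i" "{1..r+t}"] by (auto simp: Z_def)
    then obtain c where "c \<in> {1..r+t}" "\<forall>i\<in>{1..r}. c \<notin> Z i"
      by blast
    then have "common e c"
      using v(1) by (auto simp: common_def Z_def)
    then show ?thesis ..
  qed
  have f_common: "common e (f e)" if "e \<in> edges H" for e
  proof (cases "\<exists>c. common e c \<and> labelled e c")
    case True
    then show ?thesis
      unfolding f_def if_P[OF True] using someI_ex[OF True] by simp
  next
    case False
    then show ?thesis
      unfolding f_def if_not_P[OF False] using someI_ex[OF ex_common[OF that]] by simp
  qed
  have labelled_unique: "c = d" if e: "e \<in> edges H" "labelled e c" "labelled e d" for e c d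
  proof -
    obtain v where v: "e = v ` {1..r}" "\<forall>i\<in>{1..r}. v i \<in> V i"
      by (rule edgeE[OF e(1)])
    \<comment> \<open>One of three distinct vertices is neither exception and carries both
      labels.\<close>
    have "v 1 \<in> e" "v 2 \<in> e" "v 3 \<in> e"
      using v r by auto
    moreover have "v 1 \<noteq> v 2" "v 1 \<noteq> v 3" "v 2 \<noteq> v 3"
      using inj[OF _ _ _ v(2), of 1 2] inj[OF _ _ _ v(2), of 1 3] inj[OF _ _ _ v(2), of 2 3] r by auto
    ultimately show ?thesis
      using e(2,3) unfolding labelled_def by (metis Diff_iff singletonD)
  qed
  have f_eq: "f e = c" if "e \<in> edges H" "common e c" "labelled e c" for e c
    using that someI[of "\<lambda>c. common e c \<and> labelled e c" c] labelled_unique[OF that(1)]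
    unfolding f_def by auto
  have "V i \<noteq> {}" if "i \<in> {1..r}" for i
    using ex that unit_vector[of 1 "r + t" 0 t "?m i"] r by fastforce
  then have "complete_partite r H"
    unfolding complete_partite_def using disj edges_H verts_H by blast
  moreover have "spanning_coloring H (r + t) f"
    unfolding spanning_coloring_def
  proof (intro conjI ballI)
    show "f e \<in> {1..r+t}" if "e \<in> edges H" for e
      using f_common[OF that] by (simp add: common_def)
    fix x c assume x: "x \<in> verts H" and c: "c \<in> {1..r+t}"
    obtain i where i: "i \<in> {1..r}" "x \<in> V i"
      using x verts_H by blast
    have "coord x \<in> {1..r+t} \<rightarrow>\<^sub>E {..t}"
      using coord i by (simp add: vectors_def)
    then have le_t: "coord x c \<le> t"
      using c by (auto simp: PiE_iff)
    \<comment> \<open>With at most one nonzero entry, this vector occurs in every part; it shares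
      coordinate \<open>c\<close> with \<open>x\<close>.\<close>
    let ?u = "\<lambda>d\<in>{1..r+t}. if d = c then coord x c else 0"
    have "?u \<in> vectors (r + t) t (?m j)" for j
      using c le_t r by (intro unit_vector) auto
    then have "\<exists>v\<in>V j. coord v = ?u \<and> label v = c" if "j \<in> {1..r}" for j
      using ex that c by blast
    then obtain w where w: "\<And>j. j \<in> {1..r} \<Longrightarrow> w j \<in> V j \<and> coord (w j) = ?u \<and> label (w j) = c"
      by metis
    let ?e = "(w(i := x)) ` {1..r}"
    have "\<forall>j\<in>{1..r}. (w(i := x)) j \<in> V j"
      using w i by simp
    then have e: "?e \<in> edges H"
      unfolding edges_H by blast
    have coord_e: "coord a c = coord x c" if "a \<in> ?e" for a
      using that w c by (auto split: if_splits)
    then have "common ?e c"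
      using c by (simp add: common_def)
    moreover have "labelled ?e c"
      unfolding labelled_def using w by (intro exI[of _ x]) auto
    ultimately have "f ?e = c"
      using f_eq e by blast
    moreover have "x \<in> ?e"
      using i by (metis fun_upd_same imageI)
    ultimately show "\<exists>e\<in>edges H. x \<in> e \<and> f e = c"
      using e by blast
  qed
  moreover have "\<not> coverable H (r + t) f t"
  proof
    assume "coverable H (r + t) f t"
    then obtain S where S: "finite S" "card S \<le> t" "\<forall>C\<in>S. mono_component H (r + t) f C"
      and cover: "verts H \<subseteq> (\<Union>C\<in>S. verts C)"
      unfolding coverable_def by blast
    \<comment> \<open>Since \<open>f\<close> picks common coordinates only, coordinate
      \<open>c\<close> is constant along edges of colour \<open>c\<close>, hence on a
      component.\<close>
    have "\<exists>c a. c \<in> {1..r+t} \<and> (\<forall>x\<in>verts C. coord x c = a)" if C: "C \<in> S" for C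
    proof -
      obtain c where c: "c \<in> {1..r+t}" "component (color_class H f c) C"
        using S(3) C unfolding mono_component_def by blast
      have inv: "coord a c = coord b c" if "e \<in> edges C" "a \<in> e" "b \<in> e" for e a b
        using f_common[of e] that c(2)
        by (auto simp: component_def subhypergraph_def color_class_def common_def)
      have "coord x c = coord y c" if "x \<in> verts C" "y \<in> verts C" for x y
      proof (rule joined_invariant[of C x y "\<lambda>x. coord x c"])
        show "joined C x y"
          using c(2) that unfolding component_def connected_hypergraph_def by blast
      qed (rule inv)
      then show ?thesis
        using c(1) by metis
    qed
    then obtain color val where cv: "\<And>C. C \<in> S \<Longrightarrow> color C \<in> {1..r+t}"
      "\<And>C x. C \<in> S \<Longrightarrow> x \<in> verts C \<Longrightarrow> coord x (color C) = val C"
      by metis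
    \<comment> \<open>One component takes the value 0, so the at most \<open>t - 1\<close> others
      leave one of \<open>t\<close> nonzero values free.\<close>
    have free: "\<exists>a\<in>{1..t}. \<forall>C\<in>S. color C = c \<longrightarrow> val C \<noteq> a"
      if zero: "\<exists>C\<in>S. color C = c \<and> val C = 0" for c
    proof -
      obtain C where C: "C \<in> S" "color C = c" "val C = 0"
        using zero by blast
      have "card (val ` (S - {C})) < t"
        using card_image_le[of "S - {C}" val] card_Diff1_less[OF S(1) C(1)] S(1,2) by simp
      then have "\<not> {1..t} \<subseteq> val ` (S - {C})"
        using card_mono[of "val ` (S - {C})" "{1..t}"] S(1) by auto
      then obtain a where a: "a \<in> {1..t}" "a \<notin> val ` (S - {C})"
        by blast
      have "val C' \<noteq> a" if "C' \<in> S" for C'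
        using a C(3) that by (cases "C' = C") auto
      then show ?thesis
        using a(1) by blast
    qed
    then obtain w where w: "\<And>c. \<exists>C\<in>S. color C = c \<and> val C = 0 \<Longrightarrow>
        w c \<in> {1..t} \<and> (\<forall>C\<in>S. color C = c \<longrightarrow> val C \<noteq> w c)"
      by metis
    \<comment> \<open>Entries are 0 except where a component of \<open>S\<close> forbids it, hence
      in at most \<open>card S \<le> t\<close> colours; this keeps \<open>x\<close> available in the
      first part.\<close>
    define x where "x = (\<lambda>c\<in>{1..r+t}. if \<exists>C\<in>S. color C = c \<and> val C = 0 then w c else 0)"
    have x_free: "x c \<in> {1..t} \<and> (\<forall>C\<in>S. color C = c \<longrightarrow> val C \<noteq> x c)"
      if "\<exists>C\<in>S. color C = c \<and> val C = 0" "c \<in> {1..r+t}" for c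
      using w[OF that(1)] that unfolding x_def by simp
    have x_0: "x c = 0" if "\<not> (\<exists>C\<in>S. color C = c \<and> val C = 0)" "c \<in> {1..r+t}" for c
      using that(2) by (simp only: x_def restrict_apply that(1) if_True if_False)
    have x_ne: "x (color C) \<noteq> val C" if "C \<in> S" for C
      using x_free[of "color C"] x_0[of "color C"] cv(1)[OF that] that by metis
    have "{c\<in>{1..r+t}. x c \<noteq> 0} \<subseteq> color ` S"
    proof
      fix c assume "c \<in> {c\<in>{1..r+t}. x c \<noteq> 0}"
      then have "c \<in> {1..r+t}" "x c \<noteq> 0"
        by simp_all
      then have "\<exists>C\<in>S. color C = c \<and> val C = 0"
        using x_0 by metis
      then show "c \<in> color ` S"
        by blast
    qed
    then have "card {c\<in>{1..r+t}. x c \<noteq> 0} \<le> card (color ` S)"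
      using S(1) by (intro card_mono) auto
    also have "\<dots> \<le> t"
      using card_image_le[OF S(1), of color] S(2) by linarith
    finally have "card {c\<in>{1..r+t}. x c \<noteq> 0} \<le> t" .
    moreover have "x c \<le> t" if "c \<in> {1..r+t}" for c
      using x_free[OF _ that] x_0[OF _ that] by fastforce
    then have "x \<in> {1..r+t} \<rightarrow>\<^sub>E {..t}"
      by (intro PiE_I) (auto simp: x_def)
    ultimately have "x \<in> vectors (r + t) t (?m 1)"
      by (simp add: vectors_def)
    moreover have "1 \<in> {1..r}" "1 \<in> {1..r+t}"
      using r by auto
    ultimately obtain v where v: "v \<in> V 1" "coord v = x"
      using ex by blast
    then have "v \<in> verts H"
      using verts_H \<open>1 \<in> {1..r}\<close> by blast
    then obtain C where "C \<in> S" "v \<in> verts C"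
      using cover by blast
    then show False
      using cv(2) x_ne v(2) by metis
  qed
  moreover have "finite (verts H)"
    using fin verts_H by simp
  ultimately show ?thesis
    by blast
qed

theorem theorem1p7:
  fixes r t :: nat
  assumes "r \<ge> 3" and "t \<ge> r"
  shows "cov TYPE('v::infinite) r (r + t) = t + 1 \<and>
    (\<forall>(H :: 'v hypergraph) f.
       complete_partite r H \<and> spanning_coloring H (r + t) f \<longrightarrow>
       coverable H (r + t) f (t + 1)) \<and>
    (\<exists>(H :: 'v hypergraph) f.
       finite (verts H) \<and> complete_partite r H \<and> spanning_coloring H (r + t) f \<and>
       \<not> coverable H (r + t) f t)"
proof (intro conjI)
  show upper: "\<forall>(H :: 'v hypergraph) f.
      complete_partite r H \<and> spanning_coloring H (r + t) f \<longrightarrow> coverable H (r + t) f (t + 1)"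
    using coverable_spanning_coloring assms by blast
  show lower: "\<exists>(H :: 'v hypergraph) f.
      finite (verts H) \<and> complete_partite r H \<and> spanning_coloring H (r + t) f \<and>
      \<not> coverable H (r + t) f t"
    using assms by (intro not_coverable_lower) auto
  show "cov TYPE('v) r (r + t) = t + 1"
    unfolding cov_def
  proof (rule Least_equality)
    fix l
    assume l: "\<forall>(H :: 'v hypergraph) f.
      complete_partite r H \<and> spanning_coloring H (r + t) f \<longrightarrow> coverable H (r + t) f l"
    show "t + 1 \<le> l"
    proof (rule ccontr)
      assume "\<not> t + 1 \<le> l"
      then have "l \<le> t"
        by simp
      \<comment> \<open>Coverability is monotone in the bound, so \<open>l \<le> t\<close>
        contradicts the lower bound.\<close>
      have "coverable H (r + t) f t" if "coverable H (r + t) f l" for H :: "'v hypergraph" and f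
        using that le_trans[OF _ \<open>l \<le> t\<close>] unfolding coverable_def by blast
      then show False
        using l lower by blast
    qed
  qed (rule upper)
qed

end
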